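(* Let $U$ be an orthogonal transformation of $\mathbb{R}^d$ and $P\subseteq\mathbb{R}^d$ a set. There exists a set $Q\subseteq\mathbb{R}^d$ with $P\subseteq Q=UQ^\circ\subseteq UP^\circ$ if and only if both: (1) there exists a closed convex set $R\subseteq\mathbb{R}^d$ with $U^2R=R$ and $P\subseteq R\subseteq UR^\circ\subseteq UP^\circ$; and (2) for such an $R$ there exists a finite collection $S_1,\dots,S_n$ of closed convex subsets of $\mathbb{R}^d$ with $U^2S_i=S_i$ and $S_i\subseteq US_i^\circ$ for all $i$, and $UR^\circ\subseteq S_1\cup\cdots\cup S_n$. Moreover, the same equivalence holds when $Q$, $R$ and all $S_i$ are additionally required to be polyhedral.
   Context: For $A\subseteq\mathbb{R}^d$, the polar is $A^\circ=\{x\in\mathbb{R}^d:\langle x,a\rangle\le 1\text{ for all }a\in A\}$. A set is polyhedral if it is a finite intersection of closed halfspaces. An orthogonal transformation is a linear map $U$ with $U^T=U^{-1}$. *)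

theory Defs
  imports "HOL-Analysis.Analysis"
begin

definition polar :: "'a::real_inner set \<Rightarrow> 'a set"
  where "polar A = {x. \<forall>a\<in>A. x \<bullet> a \<le> 1}"

end

theory Submission imports Defs begin

text \<open>
  Write $f(A) = U A^\circ$, so that $x \in f(A)$ iff $\langle x, U y\rangle \le 1$ for all $y \in A$.
  Given $R$ and the $S_i$, enlarge $R$ step by step, replacing it by $R \cup (S_i \cap f(R))$.
  Invariance under $U^2$ makes the relation $\langle x, U y\rangle \le 1$ between $R$ and $f(R)$
  symmetric, so each step preserves $R \subseteq f(R)$, and after step $i$ all points of $f(R)$ in
  $S_i$ belong to $R$. Since $f(R)$ stays inside the union of the $S_i$, the last set $Q$ satisfies
  $f(Q) \subseteq Q$, hence $Q = f(Q)$; no convex hulls need to be taken, as $f(Q)$ is closed and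
  convex anyway. In the polyhedral case $f(R \cup T) = f(R) \cap f(T)$ remains polyhedral because
  the polar of a polyhedron is a polyhedron.
\<close>

section \<open>Polars\<close>

lemma polar_Un: "polar (A \<union> B) = polar A \<inter> polar B"
  by (auto simp: polar_def)

lemma polar_antimono: "A \<subseteq> B \<Longrightarrow> polar B \<subseteq> polar A"
  by (auto simp: polar_def)

lemma zero_in_polar: "0 \<in> polar A"
  by (simp add: polar_def)

lemma polar_eq_INT: "polar A = (\<Inter>a\<in>A. {x. a \<bullet> x \<le> 1})"
  by (auto simp: polar_def inner_commute)

lemma closed_polar: "closed (polar A)"
  unfolding polar_eq_INT by (intro closed_INT ballI closed_halfspace_le)

lemma convex_polar: "convex (polar A)"
  unfolding polar_eq_INT by (intro convex_INT convex_halfspace_le)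

text \<open>Bipolar theorem, by strict separation of an outside point; because 0 lies in the set,
  the offset of the hyperplane is negative and the normal can be rescaled into the polar.\<close>

lemma polar_polar:
  fixes A :: "'a::euclidean_space set"
  assumes "closed A" "convex A" "0 \<in> A"
  shows "polar (polar A) = A"
proof
  show "A \<subseteq> polar (polar A)"
    by (auto simp: polar_def inner_commute)
  show "polar (polar A) \<subseteq> A"
  proof
    fix x assume x: "x \<in> polar (polar A)"
    show "x \<in> A"
    proof (rule ccontr)
      assume "x \<notin> A"
      then obtain a b where ax: "a \<bullet> x < b" and b: "\<And>y. y \<in> A \<Longrightarrow> b < a \<bullet> y"
        using separating_hyperplane_closed_point[of A x] assms by blast
      have "b < 0" using b[OF assms(3)] by simp
      \<comment> \<open>Dividing by the negative \<open>b\<close> reverses the inequalities: the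
        value is below 1 on \<open>A\<close> but above 1 at \<open>x\<close>.\<close>
      have "(1 / b) *\<^sub>R a \<in> polar A"
        unfolding polar_def using b \<open>b < 0\<close> by (auto simp: field_simps less_imp_le)
      then have "x \<bullet> ((1 / b) *\<^sub>R a) \<le> 1"
        using x unfolding polar_def[of "polar A"] by blast
      then show False
        using ax \<open>b < 0\<close> by (simp add: field_simps inner_commute)
    qed
  qed
qed

section \<open>Polars of polyhedra\<close>

text \<open>For a cone the separating offset can be moved to 0, since points can be rescaled inside
  it. This supplies the Farkas argument in \<open>polyhedron_polar\<close>.\<close>

lemma separating_hyperplane_closed_convex_cone:
  fixes C :: "'a::euclidean_space set"
  assumes "closed C" "convex_cone C" "z \<notin> C"
  obtains a where "0 < a \<bullet> z" "\<And>x. x \<in> C \<Longrightarrow> a \<bullet> x \<le> 0"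
proof -
  obtain a b where az: "a \<bullet> z < b" and b: "\<And>x. x \<in> C \<Longrightarrow> b < a \<bullet> x"
    using separating_hyperplane_closed_point[of C z] assms by (auto simp: convex_cone_def)
  have "b < 0"
    using b[OF convex_cone_contains_0[OF assms(2)]] by simp
  have "0 \<le> a \<bullet> x" if "x \<in> C" for x
  proof (rule ccontr)
    assume neg: "\<not> 0 \<le> a \<bullet> x"
    \<comment> \<open>The factor is nonnegative and makes the inner product with \<open>a\<close>
      exactly \<open>b\<close>, against the strict bound.\<close>
    then have "(b / (a \<bullet> x)) *\<^sub>R x \<in> C"
      using \<open>b < 0\<close> by (intro convex_cone_scaleR[OF assms(2) _ that]) (simp add: divide_nonpos_nonpos)
    from b[OF this] show False using neg by simp
  qed
  then show ?thesis
    using that[of "- a"] az \<open>b < 0\<close> by simp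
qed

text \<open>Needed to come back from the homogenising cone, which lives one dimension higher: fixing
  the second coordinate only shifts the right-hand sides.\<close>

lemma polyhedron_slice:
  fixes S :: "('a::euclidean_space \<times> 'b::euclidean_space) set"
  assumes "polyhedron S"
  shows "polyhedron {y. (y, t) \<in> S}"
proof -
  obtain F where F: "finite F" "S = \<Inter>F" "\<And>h. h \<in> F \<Longrightarrow> \<exists>a b. a \<noteq> 0 \<and> h = {x. a \<bullet> x \<le> b}"
    using assms by (auto simp: polyhedron_def)
  have "polyhedron {y. (y, t) \<in> h}" if "h \<in> F" for h
  proof -
    obtain a b where "h = {x. a \<bullet> x \<le> b}" using F(3)[OF \<open>h \<in> F\<close>] by blast
    \<comment> \<open>\<open>fst a\<close> may vanish although \<open>a\<close> does not; the slice
      is then empty or the whole space.\<close>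
    then have "{y. (y, t) \<in> h} = {y. fst a \<bullet> y \<le> b - snd a \<bullet> t}"
      by (auto simp: inner_prod_def)
    then show ?thesis by (simp add: polyhedron_halfspace_le)
  qed
  moreover have "{y. (y, t) \<in> S} = \<Inter>((\<lambda>h. {y. (y, t) \<in> h}) ` F)"
    using F(2) by auto
  ultimately show ?thesis
    using F(1) by (metis (no_types, lifting) finite_imageI imageE polyhedron_Inter)
qed

lemma polyhedron_polar:
  fixes A :: "'a::euclidean_space set"
  assumes "polyhedron A"
  shows "polyhedron (polar A)"
proof (cases "A = {}")
  case True
  then show ?thesis by (simp add: polar_def)
next
  case False
  then obtain x0 where x0: "x0 \<in> A" by blast
  obtain F where F: "finite F" "A = \<Inter>F" "\<forall>h\<in>F. \<exists>a b. a \<noteq> 0 \<and> h = {x. a \<bullet> x \<le> b}"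
    using assms by (auto simp: polyhedron_def)
  then obtain a b where ab: "\<And>h. h \<in> F \<Longrightarrow> h = {x. a h \<bullet> x \<le> b h}"
    by metis
  have mem_A: "x \<in> A \<longleftrightarrow> (\<forall>h\<in>F. a h \<bullet> x \<le> b h)" for x
    using F(2) ab by blast
  \<comment> \<open>The polar cone of the homogenisation of A is generated by the rows of the system
      defining A; by Farkas' lemma, polar A is its slice at height -1.\<close>
  define W where "W = insert (0, -1) ((\<lambda>h. (a h, - b h)) ` F)"
  define G where "G = convex_cone hull W"
  have "polyhedron G"
    unfolding G_def W_def using F(1) by (intro polyhedron_convex_cone_hull) auto
  have cone: "convex_cone G"
    by (simp add: G_def convex_cone_convex_cone_hull)
  have W_G: "W \<subseteq> G"
    by (simp add: G_def hull_subset)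
  have "y \<in> polar A \<longleftrightarrow> (y, -1) \<in> G" for y
  proof
    assume y: "(y, -1) \<in> G"
    have "y \<bullet> x \<le> 1" if "x \<in> A" for x
    proof -
      \<comment> \<open>The generators pair nonpositively with \<open>(x, 1)\<close> because
        \<open>x\<close> solves the system, and this passes to the cone they generate.\<close>
      have "G \<subseteq> {g. (x, 1) \<bullet> g \<le> 0}"
        unfolding G_def
      proof (rule hull_minimal)
        show "W \<subseteq> {g. (x, 1) \<bullet> g \<le> 0}"
          using that mem_A by (auto simp: W_def inner_commute)
      qed (rule convex_cone_halfspace_le)
      then show ?thesis using y by (auto simp: inner_commute)
    qed
    then show "y \<in> polar A" by (simp add: polar_def)
  next
    assume y: "y \<in> polar A"
    show "(y, -1) \<in> G"
    proof (rule ccontr)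
      assume "(y, -1) \<notin> G"
      then obtain u t where sep: "0 < (u, t) \<bullet> (y, -1 :: real)"
        and le: "\<And>g. g \<in> G \<Longrightarrow> (u, t) \<bullet> g \<le> 0"
        using separating_hyperplane_closed_convex_cone[OF polyhedron_imp_closed[OF \<open>polyhedron G\<close>] cone]
        by (metis surj_pair)
      have ht: "a h \<bullet> u \<le> b h * t" if "h \<in> F" for h
        using le[of "(a h, - b h)"] that W_G
        by (auto simp: W_def inner_commute mult.commute)
      \<comment> \<open>This is the purpose of the generator \<open>(0, -1)\<close>.\<close>
      have "0 \<le> t"
        using le[of "(0, -1)"] W_G by (auto simp: W_def)
      have yu: "t < y \<bullet> u" using sep by (simp add: inner_commute)
      show False
      proof (cases "t = 0")
        case True
        \<comment> \<open>With \<open>t = 0\<close>, \<open>u\<close> is a recession direction of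
          \<open>A\<close>, and the inner product with \<open>y\<close> grows without bound along
          this ray.\<close>
        have "x0 + s *\<^sub>R u \<in> A" if "0 \<le> s" for s
          unfolding mem_A
        proof
          fix h assume h: "h \<in> F"
          have "s * (a h \<bullet> u) \<le> 0"
            using ht[OF h] True that by (simp add: mult_nonneg_nonpos)
          moreover have "a h \<bullet> x0 \<le> b h" using x0 mem_A h by blast
          ultimately show "a h \<bullet> (x0 + s *\<^sub>R u) \<le> b h"
            by (simp add: inner_add_right)
        qed
        then have bound: "y \<bullet> x0 + s * (y \<bullet> u) \<le> 1" if "0 \<le> s" for s
          using y that by (fastforce simp: polar_def inner_add_right)
        have "0 < y \<bullet> u" using yu True by simp
        moreover have "y \<bullet> x0 \<le> 1" using bound[of 0] by simp
        \<comment> \<open>The chosen parameter would give the value 2 on the ray.\<close>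
        ultimately show False
          using bound[of "(2 - y \<bullet> x0) / (y \<bullet> u)"] by simp
      next
        case False
        with \<open>0 \<le> t\<close> have "0 < t" by simp
        \<comment> \<open>Rescaled to height 1, the separating vector becomes a point of
          \<open>A\<close> at which \<open>y\<close> exceeds the bound 1.\<close>
        then have "(1 / t) *\<^sub>R u \<in> A"
          using ht by (auto simp: mem_A field_simps)
        then have "y \<bullet> ((1 / t) *\<^sub>R u) \<le> 1"
          using y by (auto simp: polar_def)
        then show False using yu \<open>0 < t\<close> by (simp add: field_simps)
      qed
    qed
  qed
  then have "polar A = {y. (y, -1) \<in> G}" by blast
  then show ?thesis
    using polyhedron_slice[OF \<open>polyhedron G\<close>] by simp
qed

section \<open>Self-polarity twisted by an orthogonal transformation\<close>

lemma polar_orthogonal_image: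
  fixes U :: "'a::euclidean_space \<Rightarrow> 'a"
  assumes "orthogonal_transformation U"
  shows "polar (U ` A) = U ` polar A"
proof
  show "U ` polar A \<subseteq> polar (U ` A)"
    using assms by (auto simp: polar_def orthogonal_transformation_def)
  show "polar (U ` A) \<subseteq> U ` polar A"
  proof
    fix x assume x: "x \<in> polar (U ` A)"
    obtain y where "x = U y"
      using orthogonal_transformation_surj[OF assms] by (metis surjD)
    with x assms show "x \<in> U ` polar A"
      by (auto simp: polar_def orthogonal_transformation_def)
  qed
qed

lemma mem_orthogonal_image_polar:
  fixes U :: "'a::euclidean_space \<Rightarrow> 'a"
  assumes "orthogonal_transformation U"
  shows "x \<in> U ` polar A \<longleftrightarrow> (\<forall>y\<in>A. x \<bullet> U y \<le> 1)"
  unfolding polar_orthogonal_image[OF assms, symmetric] by (simp add: polar_def)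

lemma funpow_2_image: "(f ^^ 2) ` A = f ` f ` A"
  by (auto simp: numeral_2_eq_2)

lemma orthogonal_image_polar_Un:
  fixes U :: "'a::euclidean_space \<Rightarrow> 'a"
  assumes "orthogonal_transformation U"
  shows "U ` polar (A \<union> B) = U ` polar A \<inter> U ` polar B"
  by (simp add: polar_Un image_Int[OF orthogonal_transformation_inj[OF assms]])

lemma orthogonal_image_polar_invariant:
  fixes U :: "'a::euclidean_space \<Rightarrow> 'a"
  assumes "orthogonal_transformation U" "(U ^^ 2) ` A = A"
  shows "(U ^^ 2) ` U ` polar A = U ` polar A"
  by (metis assms funpow_2_image polar_orthogonal_image)

text \<open>The twisted form of the inclusion of a set in its bipolar. Invariance lets
  \<open>x\<close> be written as \<open>U (U z)\<close>, and cancelling one \<open>U\<close> turns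
  \<open>x \<bullet> U y\<close> into \<open>U z \<bullet> y\<close>, which is bounded by the choice
  of \<open>y\<close>.\<close>

lemma subset_orthogonal_image_polar_twice:
  fixes U :: "'a::euclidean_space \<Rightarrow> 'a"
  assumes "orthogonal_transformation U" "(U ^^ 2) ` A = A"
  shows "A \<subseteq> U ` polar (U ` polar A)"
proof
  fix x assume "x \<in> A"
  then obtain z where z: "z \<in> A" "x = U (U z)"
    using assms(2) by (metis funpow_2_image imageE)
  have "x \<bullet> U y \<le> 1" if "y \<in> U ` polar A" for y
    using that z assms(1)
    by (auto simp: mem_orthogonal_image_polar[OF assms(1)] orthogonal_transformation_def inner_commute)
  then show "x \<in> U ` polar (U ` polar A)"
    by (simp add: mem_orthogonal_image_polar[OF assms(1)])
qed

lemma polyhedron_orthogonal_image_polar: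
  fixes U :: "'a::euclidean_space \<Rightarrow> 'a"
  assumes "orthogonal_transformation U" "polyhedron A"
  shows "polyhedron (U ` polar A)"
  using polyhedron_polar[OF assms(2)]
    polyhedron_linear_image_eq[OF orthogonal_transformation_linear[OF assms(1)]
      orthogonal_transformation_bij[OF assms(1)]]
  by simp

lemma self_polar_closed_convex_invariant:
  fixes U :: "'a::euclidean_space \<Rightarrow> 'a"
  assumes U: "orthogonal_transformation U" and Q: "Q = U ` polar Q"
  shows "closed Q" "convex Q" "(U ^^ 2) ` Q = Q"
proof -
  have lin: "linear U" using U by (rule orthogonal_transformation_linear)
  show "closed Q"
    by (subst Q, rule closed_injective_linear_image)
      (use lin U closed_polar orthogonal_transformation_inj in auto)
  show "convex Q"
    by (subst Q) (rule convex_linear_image[OF lin convex_polar])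
  have "0 \<in> Q"
    by (subst Q) (metis zero_in_polar image_eqI lin linear_0)
  then have "polar (U ` polar Q) = U ` Q"
    using polar_polar[OF \<open>closed Q\<close> \<open>convex Q\<close>] polar_orthogonal_image[OF U, of "polar Q"] by simp
  then have "polar Q = U ` Q"
    unfolding Q[symmetric] .
  then show "(U ^^ 2) ` Q = Q"
    unfolding funpow_2_image by (metis Q)
qed

text \<open>With T the added piece, four inclusions are needed: R and T each in f(R) and in f(T).
  The only one that is not immediate, R in f(T), follows from R in f(f(R)), as f reverses inclusions
  and T lies in f(R).\<close>

lemma self_polar_extension_step:
  fixes U :: "'a::euclidean_space \<Rightarrow> 'a"
  assumes U: "orthogonal_transformation U"
    and R: "(U ^^ 2) ` R = R" "R \<subseteq> U ` polar R"
    and S: "(U ^^ 2) ` S = S" "S \<subseteq> U ` polar S"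
  defines "R' \<equiv> R \<union> (S \<inter> U ` polar R)"
  shows "(U ^^ 2) ` R' = R'" "R' \<subseteq> U ` polar R'"
proof -
  have "inj (U ^^ 2)"
    using U by (intro inj_fn orthogonal_transformation_inj)
  then show "(U ^^ 2) ` R' = R'"
    unfolding R'_def
    by (simp add: image_Un image_Int R(1) S(1) orthogonal_image_polar_invariant[OF U R(1)])
  show "R' \<subseteq> U ` polar R'"
  proof -
    define T where "T = S \<inter> U ` polar R"
    have "R \<subseteq> U ` polar T"
      using subset_orthogonal_image_polar_twice[OF U R(1)]
        image_mono[OF polar_antimono[of T "U ` polar R"], of U]
      unfolding T_def by blast
    moreover have "T \<subseteq> U ` polar T"
      using S(2) image_mono[OF polar_antimono[of T S], of U] unfolding T_def by blast
    moreover have "T \<subseteq> U ` polar R"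
      by (simp add: T_def)
    ultimately show ?thesis
      using R(2) unfolding R'_def T_def[symmetric] orthogonal_image_polar_Un[OF U] by simp
  qed
qed

text \<open>Induction over the pieces of the cover. The enlarged set is a union and may fail to be
  convex along the way, so polyhedrality is carried for its image under f instead.\<close>

lemma self_polar_extension:
  fixes U :: "'a::euclidean_space \<Rightarrow> 'a" and S :: "nat \<Rightarrow> 'a set"
  assumes U: "orthogonal_transformation U"
    and R: "(U ^^ 2) ` R = R" "R \<subseteq> U ` polar R"
    and S: "\<forall>i\<in>{1..n}. (U ^^ 2) ` S i = S i \<and> S i \<subseteq> U ` polar (S i)"
  shows "\<exists>R'. R \<subseteq> R' \<and> (U ^^ 2) ` R' = R' \<and> R' \<subseteq> U ` polar R' \<and>
    (\<forall>i\<in>{1..n}. S i \<inter> U ` polar R' \<subseteq> R') \<and>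
    (polyhedron R \<longrightarrow> (\<forall>i\<in>{1..n}. polyhedron (S i)) \<longrightarrow> polyhedron (U ` polar R'))"
  using S
proof (induction n)
  case 0
  then show ?case using R polyhedron_orthogonal_image_polar[OF U] by (intro exI[of _ R]) auto
next
  case (Suc n)
  have "\<forall>i\<in>{1..n}. (U ^^ 2) ` S i = S i \<and> S i \<subseteq> U ` polar (S i)"
    using Suc.prems by simp
  from Suc.IH[OF this] obtain R' where R': "R \<subseteq> R'" "(U ^^ 2) ` R' = R'" "R' \<subseteq> U ` polar R'"
      "\<forall>i\<in>{1..n}. S i \<inter> U ` polar R' \<subseteq> R'"
      "polyhedron R \<longrightarrow> (\<forall>i\<in>{1..n}. polyhedron (S i)) \<longrightarrow> polyhedron (U ` polar R')"
    by (elim exE conjE)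
  define T where "T = S (Suc n) \<inter> U ` polar R'"
  have S: "(U ^^ 2) ` S (Suc n) = S (Suc n)" "S (Suc n) \<subseteq> U ` polar (S (Suc n))"
    using Suc.prems by auto
  show ?case
  proof (intro exI[of _ "R' \<union> T"] conjI ballI impI)
    show "R \<subseteq> R' \<union> T" using R'(1) by blast
    show "(U ^^ 2) ` (R' \<union> T) = R' \<union> T" "R' \<union> T \<subseteq> U ` polar (R' \<union> T)"
      unfolding T_def using self_polar_extension_step[OF U R'(2,3) S] by auto
  next
    fix i assume "i \<in> {1..Suc n}"
    then have "i \<in> {1..n} \<or> i = Suc n" by auto
    \<comment> \<open>For earlier pieces the inclusion persists because f(R') shrinks while R'
      grows; for the new piece it holds by the choice of \<open>T\<close>.\<close>
    then show "S i \<inter> U ` polar (R' \<union> T) \<subseteq> R' \<union> T"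
      using R'(4) unfolding orthogonal_image_polar_Un[OF U] T_def by blast
  next
    assume poly: "polyhedron R" "\<forall>i\<in>{1..Suc n}. polyhedron (S i)"
    then have "polyhedron (U ` polar R')" using R'(5) by simp
    moreover from this have "polyhedron T"
      unfolding T_def using poly(2) by auto
    ultimately show "polyhedron (U ` polar (R' \<union> T))"
      unfolding orthogonal_image_polar_Un[OF U] by (simp add: polyhedron_orthogonal_image_polar[OF U])
  qed
qed

lemma self_polar_if_covered:
  fixes U :: "'a::euclidean_space \<Rightarrow> 'a" and S :: "nat \<Rightarrow> 'a set"
  assumes U: "orthogonal_transformation U"
    and R: "(U ^^ 2) ` R = R" "R \<subseteq> U ` polar R"
    and S: "\<forall>i\<in>{1..n}. (U ^^ 2) ` S i = S i \<and> S i \<subseteq> U ` polar (S i)"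
    and cover: "U ` polar R \<subseteq> (\<Union>i\<in>{1..n}. S i)"
  obtains Q where "R \<subseteq> Q" "Q = U ` polar Q" "U ` polar Q \<subseteq> U ` polar R"
    "polyhedron R \<longrightarrow> (\<forall>i\<in>{1..n}. polyhedron (S i)) \<longrightarrow> polyhedron Q"
proof -
  have "\<exists>Q. R \<subseteq> Q \<and> (U ^^ 2) ` Q = Q \<and> Q \<subseteq> U ` polar Q \<and>
      (\<forall>i\<in>{1..n}. S i \<inter> U ` polar Q \<subseteq> Q) \<and>
      (polyhedron R \<longrightarrow> (\<forall>i\<in>{1..n}. polyhedron (S i)) \<longrightarrow> polyhedron (U ` polar Q))"
    by (rule self_polar_extension[OF U R S])
  then obtain Q where Q: "R \<subseteq> Q" "Q \<subseteq> U ` polar Q" "\<forall>i\<in>{1..n}. S i \<inter> U ` polar Q \<subseteq> Q"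
    and poly: "polyhedron R \<longrightarrow> (\<forall>i\<in>{1..n}. polyhedron (S i)) \<longrightarrow> polyhedron (U ` polar Q)"
    by (elim exE conjE)
  have sub: "U ` polar Q \<subseteq> U ` polar R"
    using polar_antimono[OF Q(1)] by (rule image_mono)
  have "U ` polar Q \<subseteq> Q"
  proof
    fix x assume x: "x \<in> U ` polar Q"
    then obtain i where "i \<in> {1..n}" "x \<in> S i"
      by (metis UN_E cover sub subsetD)
    with Q(3) x show "x \<in> Q" by (meson IntI subsetD)
  qed
  with Q(2) have eq: "Q = U ` polar Q" by (rule equalityI)
  show thesis
    \<comment> \<open>The fixed-point equation transfers polyhedrality from f(Q) to \<open>Q\<close>
      itself.\<close>
    using poly by (intro that[OF Q(1) eq sub]) (unfold eq[symmetric])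
qed

text \<open>Condition (2) stands under the quantifier of (1), so both speak of the same
  \<open>R\<close>. The case \<open>n = 0\<close> cannot occur: the union would be empty, while f(R)
  contains 0.\<close>

theorem theorem7p1:
  fixes U :: "real ^ 'd \<Rightarrow> real ^ 'd" and P :: "(real ^ 'd) set"
  assumes "orthogonal_transformation U"
  shows
    "((\<exists>Q. P \<subseteq> Q \<and> Q = U ` polar Q \<and> U ` polar Q \<subseteq> U ` polar P) \<longleftrightarrow>
      (\<exists>R. closed R \<and> convex R \<and> (U ^^ 2) ` R = R \<and>
          P \<subseteq> R \<and> R \<subseteq> U ` polar R \<and> U ` polar R \<subseteq> U ` polar P \<and>
          (\<exists>(n::nat) (S :: nat \<Rightarrow> (real ^ 'd) set).
             (\<forall>i\<in>{1..n}. closed (S i) \<and> convex (S i) \<and>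
                (U ^^ 2) ` S i = S i \<and> S i \<subseteq> U ` polar (S i)) \<and>
             U ` polar R \<subseteq> (\<Union>i\<in>{1..n}. S i))))
     \<and>
     ((\<exists>Q. polyhedron Q \<and> P \<subseteq> Q \<and> Q = U ` polar Q \<and> U ` polar Q \<subseteq> U ` polar P) \<longleftrightarrow>
      (\<exists>R. polyhedron R \<and> closed R \<and> convex R \<and> (U ^^ 2) ` R = R \<and>
          P \<subseteq> R \<and> R \<subseteq> U ` polar R \<and> U ` polar R \<subseteq> U ` polar P \<and>
          (\<exists>(n::nat) (S :: nat \<Rightarrow> (real ^ 'd) set).
             (\<forall>i\<in>{1..n}. polyhedron (S i) \<and> closed (S i) \<and> convex (S i) \<and>
                (U ^^ 2) ` S i = S i \<and> S i \<subseteq> U ` polar (S i)) \<and>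
             U ` polar R \<subseteq> (\<Union>i\<in>{1..n}. S i))))"
  (is "(?Q1 \<longleftrightarrow> ?R1) \<and> (?Q2 \<longleftrightarrow> ?R2)")
proof (intro conjI iffI)
  assume ?Q1
  then obtain Q where Q: "P \<subseteq> Q" "Q = U ` polar Q" "U ` polar Q \<subseteq> U ` polar P"
    by blast
  \<comment> \<open>A self-polar \<open>Q\<close> serves both as \<open>R\<close> and as the single
    piece of the cover.\<close>
  have cover: "U ` polar Q \<subseteq> (\<Union>i\<in>{1..(1::nat)}. Q)"
    using equalityD2[OF Q(2)] by simp
  show ?R1
    by (intro exI[of _ Q] conjI exI[of _ "1::nat"] exI[of _ "\<lambda>_. Q"] ballI)
      (rule Q self_polar_closed_convex_invariant[OF assms Q(2)] equalityD1[OF Q(2)] cover)+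
next
  assume ?R1
  then obtain R S and n :: nat where "closed R" "convex R"
      and R: "(U ^^ 2) ` R = R" and P: "P \<subseteq> R" and R': "R \<subseteq> U ` polar R"
      and polar_R: "U ` polar R \<subseteq> U ` polar P"
      and S: "\<forall>i\<in>{1..n}. closed (S i) \<and> convex (S i) \<and>
        (U ^^ 2) ` S i = S i \<and> S i \<subseteq> U ` polar (S i)"
      and cover: "U ` polar R \<subseteq> (\<Union>i\<in>{1..n}. S i)"
    by (elim exE conjE)
  from S have S': "\<forall>i\<in>{1..n}. (U ^^ 2) ` S i = S i \<and> S i \<subseteq> U ` polar (S i)"
    by simp
  obtain Q where "R \<subseteq> Q" and Q: "Q = U ` polar Q" "U ` polar Q \<subseteq> U ` polar R"
    by (rule self_polar_if_covered[OF assms R R' S' cover])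
  have "P \<subseteq> Q" "U ` polar Q \<subseteq> U ` polar P"
    using subset_trans[OF P \<open>R \<subseteq> Q\<close>] subset_trans[OF Q(2) polar_R] .
  with Q(1) show ?Q1 by (intro exI[of _ Q] conjI)
next
  assume ?Q2
  then obtain Q where Q: "polyhedron Q" "P \<subseteq> Q" "Q = U ` polar Q" "U ` polar Q \<subseteq> U ` polar P"
    by blast
  have cover: "U ` polar Q \<subseteq> (\<Union>i\<in>{1..(1::nat)}. Q)"
    using equalityD2[OF Q(3)] by simp
  show ?R2
    by (intro exI[of _ Q] conjI exI[of _ "1::nat"] exI[of _ "\<lambda>_. Q"] ballI)
      (rule Q self_polar_closed_convex_invariant[OF assms Q(3)] equalityD1[OF Q(3)] cover)+
next
  assume ?R2
  then obtain R S and n :: nat where "polyhedron R" "closed R" "convex R"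
      and R: "(U ^^ 2) ` R = R" and P: "P \<subseteq> R" and R': "R \<subseteq> U ` polar R"
      and polar_R: "U ` polar R \<subseteq> U ` polar P"
      and S: "\<forall>i\<in>{1..n}. polyhedron (S i) \<and> closed (S i) \<and> convex (S i) \<and>
        (U ^^ 2) ` S i = S i \<and> S i \<subseteq> U ` polar (S i)"
      and cover: "U ` polar R \<subseteq> (\<Union>i\<in>{1..n}. S i)"
    by (elim exE conjE)
  from S have S': "\<forall>i\<in>{1..n}. (U ^^ 2) ` S i = S i \<and> S i \<subseteq> U ` polar (S i)"
    by simp
  have poly: "\<forall>i\<in>{1..n}. polyhedron (S i)"
    using S by simp
  obtain Q where "R \<subseteq> Q" and Q: "Q = U ` polar Q" "U ` polar Q \<subseteq> U ` polar R"
      and poly_Q: "polyhedron R \<longrightarrow> (\<forall>i\<in>{1..n}. polyhedron (S i)) \<longrightarrow> polyhedron Q"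
    by (rule self_polar_if_covered[OF assms R R' S' cover])
  have "polyhedron Q"
    using poly_Q \<open>polyhedron R\<close> poly by blast
  moreover have "P \<subseteq> Q" "U ` polar Q \<subseteq> U ` polar P"
    using subset_trans[OF P \<open>R \<subseteq> Q\<close>] subset_trans[OF Q(2) polar_R] .
  ultimately show ?Q2 using Q(1) by (intro exI[of _ Q] conjI)
qed

end
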